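(* Let $G=(X\cup Y,E)$ be a complete bipartite graph and $\mathcal{I}$ a partition of $X$. Let $m\ge 3$, let $I_1,I_2\in\mathcal{I}$ be distinct, $i_1\in I_1$, let $i_2,\ldots,i_m\in I_2$ be pairwise distinct and $j_1,\ldots,j_m\in Y$ pairwise distinct. Then the inequality $$(m-1)x_{i_1}+y_{j_1}-\sum_{p=1}^m z_{i_1j_p}+\sum_{p=2}^m\left(-z_{i_pj_1}+z_{i_pj_p}\right)\ge 0,$$ as well as each of its structure-preserving copyings, defines a facet of $P(G,\mathcal{I})$.
   Context: $G=(X\cup Y,E)$ is a finite complete bipartite graph with disjoint node sets $X,Y$, i.e. $E=\{\{i,j\}: i\in X, j\in Y\}$. $\mathcal{I}$ is a partition of $X$ into non-empty subsets. Vectors in $\mathbb{R}^{X\cup Y\cup E}$ are written $(x,y,z)$. Put $X^{\mathcal{I}}=\{x\in\{0,1\}^X : \sum_{i\in I}x_i\le 1\ \forall I\in\mathcal{I}\}$ and $$P(G,\mathcal{I})=\operatorname{conv}\{(x,y,z)\in\{0,1\}^{X\cup Y\cup E} : x_iy_j=z_{ij}\ \forall\{i,j\}\in E,\ x\in X^{\mathcal{I}}\}.$$ Copying: for an inequality with coefficient vector $a\in\mathbb{R}^{X\cup Y\cup E}$ and $i\in X$, let $r_i=(a_i,(a_{ij})_{j\in Y})$ be the tuple of coefficients of node $i$ and its incident edges; for $I\in\mathcal{I}$ let $H^I=\{r_i: i\in I\}$. A copying of the inequality is an inequality with the same sense, the same right-hand side and the same coefficients of the $y$-variables in which, for each $I\in\mathcal{I}$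 and each $i\in I$, the tuple $r_i$ is replaced by some tuple in $H^I$. It is structure-preserving if, for each $I\in\mathcal{I}$, every tuple in $H^I\setminus\{(0,\ldots,0)\}$ is chosen for at least one $i\in I$. *)

theory Defs
  imports "HOL-Analysis.Analysis" "HOL-Library.Disjoint_Sets"
begin

text \<open>
  The two node sets are the finite types \<open>'x\<close> and \<open>'y\<close>, which makes them disjoint and keeps
  the ambient space Euclidean; both are arbitrary. As the graph is complete
  bipartite, an edge \<open>{i, j}\<close> is the same as a pair of nodes, and the coordinate of the vector
  \<open>(x, y, z)\<close> for this edge is \<open>z $ i $ j\<close>.
\<close>

type_synonym ('x, 'y) xyz = "(real ^ 'x) \<times> (real ^ 'y) \<times> (real ^ 'y ^ 'x)"

definition multiple_choice :: "'x::finite set set \<Rightarrow> (real ^ 'x) set" where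
  "multiple_choice \<I> =
     {x. (\<forall>i. x $ i \<in> {0, 1}) \<and> (\<forall>I\<in>\<I>. (\<Sum>i\<in>I. x $ i) \<le> 1)}"

definition bqp :: "'x::finite set set \<Rightarrow> ('x, 'y::finite) xyz set" where
  "bqp \<I> = convex hull
     {(x, y, z) | x y z. x \<in> multiple_choice \<I> \<and> (\<forall>j. y $ j \<in> {0, 1}) \<and>
        (\<forall>i j. z $ i $ j \<in> {0, 1}) \<and> (\<forall>i j. x $ i * y $ j = z $ i $ j)}"

text \<open>
  The pair \<open>(a, \<beta>)\<close> stands for the inequality \<open>a \<bullet> (x, y, z) \<ge> \<beta>\<close>; the sense is always \<open>\<ge>\<close>.
\<close>

type_synonym ('x, 'y) inequality = "('x, 'y) xyz \<times> real"

definition valid_ineq ::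
  "('x::finite, 'y::finite) xyz set \<Rightarrow> ('x, 'y) inequality \<Rightarrow> bool" where
  "valid_ineq P c \<longleftrightarrow> (\<forall>v\<in>P. fst c \<bullet> v \<ge> snd c)"

definition defines_facet ::
  "('x::finite, 'y::finite) xyz set \<Rightarrow> ('x, 'y) inequality \<Rightarrow> bool" where
  "defines_facet P c \<longleftrightarrow> valid_ineq P c \<and> {v \<in> P. fst c \<bullet> v = snd c} facet_of P"

definition x_coeff :: "('x::finite, 'y::finite) inequality \<Rightarrow> 'x \<Rightarrow> real" where
  "x_coeff c i = fst (fst c) $ i"

definition y_coeff :: "('x::finite, 'y::finite) inequality \<Rightarrow> 'y \<Rightarrow> real" where
  "y_coeff c j = fst (snd (fst c)) $ j"

definition z_coeff :: "('x::finite, 'y::finite) inequality \<Rightarrow> 'x \<Rightarrow> 'y \<Rightarrow> real" where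
  "z_coeff c i j = snd (snd (fst c)) $ i $ j"

definition coeff_tuple ::
  "('x::finite, 'y::finite) inequality \<Rightarrow> 'x \<Rightarrow> real \<times> (real ^ 'y)" where
  "coeff_tuple c i = (x_coeff c i, \<chi> j. z_coeff c i j)"

definition coeff_tuples ::
  "('x::finite, 'y::finite) inequality \<Rightarrow> 'x set \<Rightarrow> (real \<times> (real ^ 'y)) set" where
  "coeff_tuples c I = coeff_tuple c ` I"

definition copying ::
  "'x::finite set set \<Rightarrow> ('x, 'y::finite) inequality \<Rightarrow> ('x, 'y) inequality \<Rightarrow> bool" where
  "copying \<I> c c' \<longleftrightarrow>
     snd c' = snd c \<and> (\<forall>j. y_coeff c' j = y_coeff c j) \<and>
     (\<forall>I\<in>\<I>. \<forall>i\<in>I. coeff_tuple c' i \<in> coeff_tuples c I)"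

definition structure_preserving_copying ::
  "'x::finite set set \<Rightarrow> ('x, 'y::finite) inequality \<Rightarrow> ('x, 'y) inequality \<Rightarrow> bool" where
  "structure_preserving_copying \<I> c c' \<longleftrightarrow>
     copying \<I> c c' \<and>
     (\<forall>I\<in>\<I>. \<forall>r \<in> coeff_tuples c I - {0}. \<exists>i\<in>I. coeff_tuple c' i = r)"

text \<open>Unit vectors, i.e. the coefficient vectors of the single variables.\<close>

definition x_unit :: "'x::finite \<Rightarrow> ('x, 'y::finite) xyz" where
  "x_unit i = (axis i 1, 0, 0)"

definition y_unit :: "'y::finite \<Rightarrow> ('x::finite, 'y) xyz" where
  "y_unit j = (0, axis j 1, 0)"

definition z_unit :: "'x::finite \<Rightarrow> 'y::finite \<Rightarrow> ('x, 'y) xyz" where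
  "z_unit i j = (0, 0, axis i (axis j 1))"

definition the_inequality ::
  "nat \<Rightarrow> (nat \<Rightarrow> 'x::finite) \<Rightarrow> (nat \<Rightarrow> 'y::finite) \<Rightarrow> ('x, 'y) inequality" where
  "the_inequality m i j =
     ((real m - 1) *\<^sub>R x_unit (i 1) + y_unit (j 1) - (\<Sum>p=1..m. z_unit (i 1) (j p))
        + (\<Sum>p=2..m. - z_unit (i p) (j 1) + z_unit (i p) (j p)), 0)"

lemma inner_units:
  "x_unit i \<bullet> (x, y, z) = x $ i" "y_unit j \<bullet> (x, y, z) = y $ j"
  "z_unit i j \<bullet> (x, y, z) = z $ i $ j"
  by (simp_all add: x_unit_def y_unit_def z_unit_def inner_axis')

lemma the_inequality_iff:
  "fst (the_inequality m i j) \<bullet> (x, y, z) \<ge> snd (the_inequality m i j) \<longleftrightarrow>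
     (real m - 1) * x $ i 1 + y $ j 1 - (\<Sum>p=1..m. z $ i 1 $ j p)
       + (\<Sum>p=2..m. - z $ i p $ j 1 + z $ i p $ j p) \<ge> 0"
  by (simp only: the_inequality_def fst_conv snd_conv inner_add_left inner_diff_left
        inner_minus_left inner_scaleR_left inner_sum_left inner_units)

end

theory Submission
  imports Defs
begin

text \<open>
  The polytope is full-dimensional and contains \<open>0\<close>, so a valid inequality \<open>a \<bullet> v \<ge> 0\<close>
  that is not an equation on it is facet-defining as soon as every \<open>b\<close> with \<open>b \<bullet> v = 0\<close> on all
  vertices tight for \<open>a\<close> is a multiple of \<open>a\<close>. In a structure-preserving copying, each node of \<open>I\<^sub>1\<close>
  carries the tuple of \<open>i\<^sub>1\<close> or zero, each node of \<open>I\<^sub>2\<close> carries the tuple of some \<open>i\<^sub>p\<close> or zero, all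
  other nodes carry zero, and every non-zero tuple occurs. Tight vertices with at most two nodes
  selected in \<open>X\<close> then determine \<open>b\<close> up to its coefficient at \<open>y\<^sub>j\<^sub>1\<close>.
\<close>

section \<open>A dimension criterion for facets\<close>

text \<open>By \<open>unique\<close>, the orthogonal complement of the span of the face lies in the
  line spanned by \<open>a\<close>, so the face has dimension at least \<open>DIM('a) - 1\<close>.
  As a proper face it has smaller affine dimension than \<open>P\<close>, which leaves a gap of
  exactly one.\<close>

lemma facet_of_if_unique_equation:
  fixes P :: "'a::euclidean_space set"
  assumes "convex P" and valid: "\<And>v. v \<in> P \<Longrightarrow> a \<bullet> v \<ge> 0" and "0 \<in> P"
    and w: "w \<in> P" "a \<bullet> w \<noteq> 0"
    and unique: "\<And>b. (\<And>v. v \<in> P \<Longrightarrow> a \<bullet> v = 0 \<Longrightarrow> b \<bullet> v = 0) \<Longrightarrow> \<exists>\<delta>. b = \<delta> *\<^sub>R a"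
  shows "{v \<in> P. a \<bullet> v = 0} facet_of P"
proof -
  define F where "F = {v \<in> P. a \<bullet> v = 0}"
  have "F = P \<inter> {v. a \<bullet> v = 0}"
    by (auto simp: F_def)
  then have face: "F face_of P"
    using face_of_Int_supporting_hyperplane_ge[OF \<open>convex P\<close>, where a = a and b = 0] valid by simp
  have zero: "0 \<in> F"
    using \<open>0 \<in> P\<close> by (simp add: F_def)
  have "F \<noteq> P"
    using w by (auto simp: F_def)
  then have lt: "aff_dim F < aff_dim P"
    using face_of_aff_dim_lt \<open>convex P\<close> face by blast
  have "{y \<in> UNIV. \<forall>x\<in>span F. orthogonal x y} \<subseteq> span {a}"
  proof
    fix b assume "b \<in> {y \<in> UNIV. \<forall>x\<in>span F. orthogonal x y}"
    then have "\<And>v. v \<in> P \<Longrightarrow> a \<bullet> v = 0 \<Longrightarrow> b \<bullet> v = 0"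
      by (auto simp: F_def orthogonal_def inner_commute span_base)
    then obtain \<delta> where "b = \<delta> *\<^sub>R a"
      using unique by blast
    then show "b \<in> span {a}"
      by (simp add: span_base span_mul)
  qed
  then have "dim {y \<in> UNIV. \<forall>x\<in>span F. orthogonal x y} \<le> dim {a}"
    by (metis dim_subset dim_span)
  also have "\<dots> \<le> 1"
    using dim_le_card'[of "{a}"] by simp
  finally have "DIM('a) \<le> dim F + 1"
    using dim_subspace_orthogonal_to_vectors[of "span F" UNIV] by simp
  \<comment> \<open>Linear and affine dimension agree because the face contains the origin.\<close>
  moreover have "aff_dim F = int (dim F)"
    using zero by (simp add: aff_dim_zero hull_inc)
  ultimately have "aff_dim F = aff_dim P - 1"
    using lt aff_dim_le_DIM[of P] by linarith
  then show ?thesis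
    using face zero unfolding facet_of_def F_def[symmetric] by auto
qed

section \<open>Vertices of the polytope as pairs of node sets\<close>

definition vertex :: "'x::finite set \<Rightarrow> 'y::finite set \<Rightarrow> ('x, 'y) xyz" where
  "vertex S T = (\<chi> i. of_bool (i \<in> S), \<chi> j. of_bool (j \<in> T), \<chi> i j. of_bool (i \<in> S \<and> j \<in> T))"

text \<open>This is what a selected node of the first side with coefficients \<open>r\<close>
  contributes to the left-hand side when \<open>T\<close> is selected on the other side.\<close>

definition tuple_val :: "real \<times> (real ^ 'y::finite) \<Rightarrow> 'y set \<Rightarrow> real" where
  "tuple_val r T = fst r + (\<Sum>j\<in>T. snd r $ j)"

lemma tuple_val_zero [simp]: "tuple_val 0 T = 0"
  by (simp add: tuple_val_def)

lemma tuple_val_insert: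
  "j \<notin> T \<Longrightarrow> tuple_val r (insert j T) = tuple_val r T + snd r $ j"
  by (simp add: tuple_val_def)

text \<open>For fixed \<open>T\<close> the left-hand side separates over the nodes of
  \<open>S\<close>, so later arguments can treat one coefficient tuple at a time.\<close>

lemma inner_vertex:
  "fst c \<bullet> vertex S T =
     (\<Sum>i\<in>S. tuple_val (coeff_tuple c i) T) + (\<Sum>j\<in>T. y_coeff c j)"
proof -
  obtain x y z \<beta> where c: "c = ((x, y, z), \<beta>)"
    by (metis prod.collapse)
  have "(\<Sum>i\<in>UNIV. \<Sum>j\<in>UNIV. z $ i $ j * of_bool (i \<in> S \<and> j \<in> T)) = (\<Sum>i\<in>S. \<Sum>j\<in>T. z $ i $ j)"
  proof -
    have "(\<Sum>j\<in>UNIV. z $ i $ j * of_bool (i \<in> S \<and> j \<in> T))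
        = (if i \<in> S then \<Sum>j\<in>T. z $ i $ j else 0)" for i
      by (simp add: of_bool_def if_distrib sum.If_cases cong: if_cong)
    then show ?thesis
      by (simp add: sum.If_cases)
  qed
  moreover have "(\<Sum>i\<in>UNIV. x $ i * of_bool (i \<in> S)) = (\<Sum>i\<in>S. x $ i)"
    and "(\<Sum>j\<in>UNIV. y $ j * of_bool (j \<in> T)) = (\<Sum>j\<in>T. y $ j)"
    by (simp_all add: of_bool_def if_distrib sum.If_cases cong: if_cong)
  ultimately show ?thesis
    by (simp add: c vertex_def inner_vec_def tuple_val_def coeff_tuple_def x_coeff_def
        y_coeff_def z_coeff_def sum.distrib)
qed

lemma inequality_eq_scaleR:
  assumes "\<And>i. coeff_tuple c i = \<delta> *\<^sub>R coeff_tuple d i"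
    and "\<And>j. y_coeff c j = \<delta> * y_coeff d j"
  shows "fst c = \<delta> *\<^sub>R fst d"
  using assms
  by (auto simp: coeff_tuple_def x_coeff_def y_coeff_def z_coeff_def prod_eq_iff vec_eq_iff)

text \<open>The multiple-choice constraint for the support of \<open>x\<close>, phrased with
  elements instead of cardinalities so that singletons and pairs are easy to check.\<close>

definition one_per_block :: "'x set set \<Rightarrow> 'x set \<Rightarrow> bool" where
  "one_per_block \<I> S \<longleftrightarrow> (\<forall>I\<in>\<I>. \<forall>i\<in>S \<inter> I. \<forall>k\<in>S \<inter> I. i = k)"

lemma vertex_in_multiple_choice_iff:
  fixes \<I> :: "'x::finite set set"
  shows "(\<chi> i. of_bool (i \<in> S)) \<in> multiple_choice \<I> \<longleftrightarrow> one_per_block \<I> S"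
proof -
  have "(\<Sum>i\<in>I. of_bool (i \<in> S)) \<le> (1::real) \<longleftrightarrow> card (S \<inter> I) \<le> 1" for I :: "'x set"
    by (simp add: of_bool_def sum.If_cases Int_commute)
  then show ?thesis
    by (simp add: multiple_choice_def one_per_block_def card_le_Suc0_iff_eq)
qed

text \<open>In a generating point \<open>x\<close> and \<open>y\<close> are 0/1 vectors and
  \<open>z\<close> is their product, so the two supports determine the point.\<close>

lemma bqp_eq:
  fixes \<I> :: "'x::finite set set"
  shows "bqp \<I> = convex hull {vertex S (T :: 'y::finite set) | S T. one_per_block \<I> S}"
proof -
  have "{(x, y, z) | x y z. x \<in> multiple_choice \<I> \<and> (\<forall>j. y $ j \<in> {0, 1}) \<and>
        (\<forall>i j. z $ i $ j \<in> {0, 1}) \<and> (\<forall>i j. x $ i * y $ j = z $ i $ j)}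
      = {vertex S (T :: 'y set) | S T. one_per_block \<I> S}" (is "?L = ?R")
  proof (intro equalityI subsetI)
    fix v assume "v \<in> ?L"
    then obtain x y z where v: "v = (x, y, z)" and x: "x \<in> multiple_choice \<I>"
      and y: "\<forall>j. y $ j \<in> {0, 1}" and z: "\<forall>i j. x $ i * y $ j = z $ i $ j"
      by auto
    have x01: "\<forall>i. x $ i \<in> {0, 1}"
      using x by (simp add: multiple_choice_def)
    have xS: "x = (\<chi> i. of_bool (i \<in> {i. x $ i = 1}))"
      using x01 by (auto simp: vec_eq_iff)
    have "v = vertex {i. x $ i = 1} {j. y $ j = 1}"
      unfolding v vertex_def using x01 y z by (auto simp: vec_eq_iff) (metis mult_cancel_left2 mult_cancel_right2 mult_eq_0_iff)+
    moreover have "one_per_block \<I> {i. x $ i = 1}"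
      using x xS vertex_in_multiple_choice_iff by metis
    ultimately show "v \<in> ?R"
      by blast
  next
    fix v assume "v \<in> ?R"
    then show "v \<in> ?L"
      by (auto simp: vertex_def vertex_in_multiple_choice_iff)
  qed
  then show ?thesis
    by (simp only: bqp_def)
qed

lemma vertex_in_bqp: "one_per_block \<I> S \<Longrightarrow> vertex S T \<in> bqp \<I>"
  unfolding bqp_eq by (rule hull_inc) blast

lemma valid_ineq_bqp_if_vertices:
  assumes "\<And>S T. one_per_block \<I> S \<Longrightarrow> fst c \<bullet> vertex S T \<ge> snd c"
  shows "valid_ineq (bqp \<I>) c"
proof -
  have "bqp \<I> \<subseteq> {v. fst c \<bullet> v \<ge> snd c}"
    unfolding bqp_eq using assms by (intro hull_minimal convex_halfspace_ge) auto
  then show ?thesis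
    by (auto simp: valid_ineq_def)
qed

section \<open>The nonzero coefficient tuples\<close>

text \<open>The tuple of \<open>i\<^sub>1\<close>, and that of \<open>i\<^sub>p\<close>, with \<open>h = j\<^sub>1\<close>, \<open>K = {j\<^sub>2, \<dots>, j\<^sub>m}\<close> and \<open>k = j\<^sub>p\<close>.\<close>

definition row1 :: "'y::finite \<Rightarrow> 'y set \<Rightarrow> real \<times> (real ^ 'y)" where
  "row1 h K = (real (card K), \<chi> j. - of_bool (j \<in> insert h K))"

definition row2 :: "'y::finite \<Rightarrow> 'y \<Rightarrow> real \<times> (real ^ 'y)" where
  "row2 h k = (0, \<chi> j. of_bool (j = k) - of_bool (j = h))"

text \<open>Each selected node of \<open>K\<close> lowers the constant \<open>card K\<close> by one,
  leaving the number of nodes of \<open>K\<close> missing from \<open>T\<close>; \<open>h\<close> is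
  counted separately as it lies outside \<open>K\<close>.\<close>

lemma tuple_val_row1:
  assumes "h \<notin> K"
  shows "tuple_val (row1 h K) T = real (card (K - T)) - of_bool (h \<in> T)"
proof -
  have "(\<Sum>j\<in>T. of_bool (j \<in> insert h K) :: real) = of_bool (h \<in> T) + card (T \<inter> K)"
  proof -
    have "(\<Sum>j\<in>T. of_bool (j \<in> insert h K) :: real) = card (T \<inter> insert h K)"
      by (simp add: of_bool_def sum.If_cases del: insert_iff)
    then show ?thesis
      using assms by (simp add: Int_insert_right)
  qed
  moreover have "card K = card (K - T) + card (T \<inter> K)"
    by (metis Int_commute add.commute card_Int_Diff finite)
  ultimately show ?thesis
    by (simp add: tuple_val_def row1_def sum_negf)
qed

lemma tuple_val_row2: "tuple_val (row2 h k) T = of_bool (k \<in> T) - of_bool (h \<in> T)"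
  by (simp add: tuple_val_def row2_def sum_subtractf of_bool_def)

section \<open>Facet proof for all structure-preserving copyings\<close>

text \<open>The assumptions keep from a structure-preserving copying only which tuples may occur in
  each block and that every nonzero one does occur. This treats the original inequality and its
  copyings alike.\<close>

locale copied_inequality =
  fixes \<I> :: "'x::finite set set" and I\<^sub>1 I\<^sub>2 :: "'x set"
    and h :: "'y::finite" and K :: "'y set" and c :: "('x, 'y) inequality"
  assumes part: "partition_on UNIV \<I>"
    and blocks: "I\<^sub>1 \<in> \<I>" "I\<^sub>2 \<in> \<I>" "I\<^sub>1 \<noteq> I\<^sub>2"
    and h: "h \<notin> K" and K: "K \<noteq> {}"
    and rhs: "snd c = 0"
    and y: "\<And>j. y_coeff c j = of_bool (j = h)"
    and I1: "\<And>i. i \<in> I\<^sub>1 \<Longrightarrow> coeff_tuple c i \<in> {0, row1 h K}"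
    and I2: "\<And>i. i \<in> I\<^sub>2 \<Longrightarrow> coeff_tuple c i \<in> insert 0 (row2 h ` K)"
    and other: "\<And>i. i \<notin> I\<^sub>1 \<Longrightarrow> i \<notin> I\<^sub>2 \<Longrightarrow> coeff_tuple c i = 0"
    and ex1: "\<exists>i\<in>I\<^sub>1. coeff_tuple c i = row1 h K"
    and ex2: "\<And>k. k \<in> K \<Longrightarrow> \<exists>i\<in>I\<^sub>2. coeff_tuple c i = row2 h k"
begin

lemma disj: "I\<^sub>1 \<inter> I\<^sub>2 = {}"
  using part blocks by (meson disjointD partition_onD2)

lemma one_per_block_empty: "one_per_block \<I> {}"
  by (simp add: one_per_block_def)

lemma one_per_block_singleton: "one_per_block \<I> {i}"
  by (simp add: one_per_block_def)

lemma one_per_block_pair: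
  assumes "i \<in> I" "k \<notin> I" "I \<in> \<I>"
  shows "one_per_block \<I> {i, k}"
proof -
  have "i \<notin> J \<or> k \<notin> J" if "J \<in> \<I>" for J
    using assms that part by (metis disjointD disjoint_iff partition_onD2)
  then show ?thesis
    by (auto simp: one_per_block_def)
qed

lemma inner_eq:
  "fst c \<bullet> vertex S T = (\<Sum>i\<in>S. tuple_val (coeff_tuple c i) T) + of_bool (h \<in> T)"
  by (simp add: inner_vertex y of_bool_def)

text \<open>At most one node of each of the two blocks contributes. Without \<open>h\<close> in
  \<open>T\<close> all contributions are nonnegative. With \<open>h\<close> in \<open>T\<close>, the
  y-term 1 offsets one contribution of -1; if both blocks contribute, the sum is still nonnegative
  since a \<open>k\<close> missing from \<open>T\<close> is counted in
  \<open>card (K - T)\<close>.\<close>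

lemma valid: "valid_ineq (bqp \<I>) c"
proof (rule valid_ineq_bqp_if_vertices)
  fix S :: "'x set" and T :: "'y set" assume S: "one_per_block \<I> S"
  let ?g = "\<lambda>i. tuple_val (coeff_tuple c i) T"
  have block_cases: "S \<inter> I = {} \<or> (\<exists>i\<in>I. S \<inter> I = {i})" if "I \<in> \<I>" for I
    using S that unfolding one_per_block_def by (cases "S \<inter> I = {}") blast+
  have "sum ?g S = sum ?g (S \<inter> (I\<^sub>1 \<union> I\<^sub>2))"
    using other by (intro sum.mono_neutral_right) auto
  also have "\<dots> = sum ?g (S \<inter> I\<^sub>1) + sum ?g (S \<inter> I\<^sub>2)"
    using disj by (subst sum.union_disjoint[symmetric]) (auto simp: Int_Un_distrib)
  finally have split: "sum ?g S = sum ?g (S \<inter> I\<^sub>1) + sum ?g (S \<inter> I\<^sub>2)" .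
  have 1: "sum ?g (S \<inter> I\<^sub>1) \<in> {0, real (card (K - T)) - of_bool (h \<in> T)}"
    using block_cases[OF blocks(1)]
  proof
    assume "\<exists>i\<in>I\<^sub>1. S \<inter> I\<^sub>1 = {i}"
    then obtain i where "i \<in> I\<^sub>1" "S \<inter> I\<^sub>1 = {i}"
      by blast
    then show ?thesis
      using I1[of i] tuple_val_row1[OF h, of T] by auto
  qed simp
  have "sum ?g (S \<inter> I\<^sub>2) = 0 \<or>
    (\<exists>k\<in>K. sum ?g (S \<inter> I\<^sub>2) = of_bool (k \<in> T) - of_bool (h \<in> T))"
    using block_cases[OF blocks(2)] I2 by (fastforce simp: tuple_val_row2)
  moreover have "real (card (K - T)) \<ge> 1" if "k \<in> K" "k \<notin> T" for k
    using that by (metis DiffI One_nat_def Suc_leI card_gt_0_iff empty_iff finite of_nat_1 of_nat_le_iff)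
  ultimately show "fst c \<bullet> vertex S T \<ge> snd c"
    using 1 unfolding inner_eq split rhs by fastforce
qed

lemma unique_equation:
  assumes tight: "\<And>v. v \<in> bqp \<I> \<Longrightarrow> fst c \<bullet> v = 0 \<Longrightarrow> b \<bullet> v = 0"
  shows "\<exists>\<delta>. b = \<delta> *\<^sub>R fst c"
proof -
  \<comment> \<open>The right-hand side 0 only makes the coefficient functions applicable to
    \<open>b\<close>. The factor must be the coefficient of \<open>b\<close> at \<open>h\<close>,
    where \<open>c\<close> has y-coefficient 1.\<close>
  define d where "d = (b, 0 :: real)"
  define \<delta> where "\<delta> = y_coeff d h"
  define f where "f i T = tuple_val (coeff_tuple d i) T" for i T
  have vanish: "(\<Sum>i\<in>S. f i T) + (\<Sum>j\<in>T. y_coeff d j) = 0"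
    if "one_per_block \<I> S" "(\<Sum>i\<in>S. tuple_val (coeff_tuple c i) T) + of_bool (h \<in> T) = 0" for S T
    using tight[OF vertex_in_bqp[OF that(1), of T]] that(2) inner_vertex[of d S T]
    by (simp add: inner_eq d_def f_def)
  have y0: "y_coeff d j = 0" if "j \<noteq> h" for j
    using vanish[OF one_per_block_empty, of "{j}"] that by simp
  have y_sum: "(\<Sum>j\<in>T. y_coeff d j) = \<delta> * of_bool (h \<in> T)" for T
  proof -
    have "(\<Sum>j\<in>T. y_coeff d j) = (\<Sum>j\<in>T. if j = h then \<delta> else 0)"
      using y0 by (intro sum.cong) (auto simp: \<delta>_def)
    then show ?thesis
      by simp
  qed
  have single: "f i T = - \<delta> * of_bool (h \<in> T)"
    if "tuple_val (coeff_tuple c i) T = - of_bool (h \<in> T)" for i T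
    using vanish[OF one_per_block_singleton[of i], of T] that by (simp add: y_sum)
  have pair: "f i T + f k T = - \<delta> * of_bool (h \<in> T)"
    if "i \<in> I" "k \<notin> I" "I \<in> \<I>"
      "tuple_val (coeff_tuple c i) T + tuple_val (coeff_tuple c k) T = - of_bool (h \<in> T)"
    for i k I T
  proof -
    have "i \<noteq> k"
      using that(1,2) by blast
    then show ?thesis
      using vanish[OF one_per_block_pair[OF that(1-3)], of T] that(4) by (simp add: y_sum)
  qed
  \<comment> \<open>Coefficients of \<open>b\<close> are recovered from values of \<open>f\<close>:
    edge coefficients are increments in \<open>T\<close>, and the node coefficient is the value at
    the empty set.\<close>
  have coord: "snd (coeff_tuple d i) $ j = f i (insert j T) - f i T" if "j \<notin> T" for i j T
    using that by (simp add: f_def tuple_val_insert)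
  have const: "fst (coeff_tuple d i) = f i {}" for i
    by (simp add: f_def tuple_val_def)
  obtain a where a: "a \<in> I\<^sub>1" "coeff_tuple c a = row1 h K"
    using ex1 by blast
  \<comment> \<open>Without \<open>h\<close> in \<open>T\<close> the node alone gives a tight
    vertex. To reach \<open>h\<close>, it is added to a tight vertex whose single node, from another
    block, contributes -1; comparing both vertices gives \<open>f i T = 0\<close>.\<close>
  have zero_row: "coeff_tuple d i = 0" if z: "coeff_tuple c i = 0" for i
  proof -
    have off: "f i T = 0" if "h \<notin> T" for T
      using single[of i T] z that by simp
    obtain T where "h \<in> T" "f i T = 0"
    proof (cases "i \<in> I\<^sub>2")
      case True
      have "f a (insert h K) = - \<delta>" "f a (insert h K) + f i (insert h K) = - \<delta>"
        using single[of a "insert h K"] pair[of a I\<^sub>1 i "insert h K"] True a z disj blocks(1) h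
        by (auto simp: tuple_val_row1)
      then show ?thesis
        by (intro that[of "insert h K"]) auto
    next
      case False
      obtain k where k: "k \<in> K"
        using K by blast
      then obtain e where e: "e \<in> I\<^sub>2" "coeff_tuple c e = row2 h k"
        using ex2 by blast
      have "k \<noteq> h"
        using h k by auto
      then have "f e {h} = - \<delta>" "f e {h} + f i {h} = - \<delta>"
        using single[of e "{h}"] pair[of e I\<^sub>2 i "{h}"] False e z blocks(2)
        by (simp_all add: tuple_val_row2)
      then show ?thesis
        by (intro that[of "{h}"]) auto
    qed
    then have "snd (coeff_tuple d i) $ h = 0"
      using coord[of h "T - {h}" i] off[of "T - {h}"] by (simp add: insert_absorb)
    moreover have "snd (coeff_tuple d i) $ j = 0" if "j \<noteq> h" for j
      using coord[of j "{}" i] off[of "{j}"] off[of "{}"] that by simp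
    ultimately show ?thesis
      using const[of i] off[of "{}"] by (metis prod.collapse vec_eq_iff zero_index zero_prod_def empty_iff)
  qed
  \<comment> \<open>Once \<open>T\<close> contains \<open>K\<close>, \<open>row1\<close> contributes
    just -1 or 0 according to \<open>h\<close>, so the node alone is tight.\<close>
  have val1: "f i K = 0" "f i (insert h K) = - \<delta>"
    "\<And>j. j \<notin> insert h K \<Longrightarrow> f i (insert j K) = 0"
    if "coeff_tuple c i = row1 h K" for i
  proof -
    show "f i K = 0" "f i (insert h K) = - \<delta>"
      using single[of i K] single[of i "insert h K"] that h by (simp_all add: tuple_val_row1)
    show "f i (insert j K) = 0" if "j \<notin> insert h K" for j
    proof -
      have "K - insert j K = {}" "h \<notin> insert j K"
        using h that by auto
      then show ?thesis
        using single[of i "insert j K"] \<open>coeff_tuple c i = row1 h K\<close>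
        by (simp add: tuple_val_row1[OF h])
    qed
  qed
  have val2: "f i T = - \<delta> * of_bool (h \<in> T)"
    if "coeff_tuple c i = row2 h k" "k \<notin> T" for i k T
    using single[of i T] that by (simp add: tuple_val_row2)
  have row2_case: "coeff_tuple d i = \<delta> *\<^sub>R row2 h k"
    if i: "i \<in> I\<^sub>2" "coeff_tuple c i = row2 h k" and k: "k \<in> K" for i k
  proof -
    have hk: "h \<noteq> k"
      using h k by auto
    \<comment> \<open>A single \<open>row2\<close> node is never tight when \<open>k\<close> is in
      \<open>T\<close>. Here the partner \<open>a\<close> contributes -1 and \<open>i\<close>
      contributes 0, which balances the y-term.\<close>
    have "f a (insert h K) + f i (insert h K) = - \<delta>"
      using pair[of a I\<^sub>1 i "insert h K"] a i k disj blocks(1) h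
      by (auto simp: tuple_val_row1 tuple_val_row2)
    then have "f i (insert h K) = 0"
      using val1(2)[OF a(2)] by simp
    then have "snd (coeff_tuple d i) $ k = \<delta>"
      using coord[of k "insert h K - {k}" i] val2[OF i(2), of "insert h K - {k}"] k hk
      by (simp add: insert_absorb)
    moreover have "snd (coeff_tuple d i) $ h = - \<delta>"
      using coord[of h "{}" i] val2[OF i(2), of "{h}"] val2[OF i(2), of "{}"] hk by simp
    moreover have "snd (coeff_tuple d i) $ j = 0" if "j \<noteq> h" "j \<noteq> k" for j
      using coord[of j "{}" i] val2[OF i(2), of "{j}"] val2[OF i(2), of "{}"] that by simp
    moreover have "fst (coeff_tuple d i) = 0"
      using const[of i] val2[OF i(2), of "{}"] by simp
    ultimately show ?thesis
      using hk by (auto simp: row2_def prod_eq_iff vec_eq_iff)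
  qed
  have row1_case: "coeff_tuple d i = \<delta> *\<^sub>R row1 h K"
    if i: "i \<in> I\<^sub>1" "coeff_tuple c i = row1 h K" for i
  proof -
    have eh: "snd (coeff_tuple d i) $ h = - \<delta>"
      using coord[of h K i] val1[OF i(2)] h by simp
    have ek: "snd (coeff_tuple d i) $ k = - \<delta>" if k: "k \<in> K" for k
    proof -
      obtain e where e: "e \<in> I\<^sub>2" "coeff_tuple c e = row2 h k"
        using ex2 k by blast
      \<comment> \<open>Omitting exactly \<open>k\<close> makes \<open>row1\<close> contribute 1 - 1
        = 0 and the matching \<open>row2\<close> contribute -1, so the pair is tight although
        \<open>i\<close> alone is not.\<close>
      let ?T = "insert h K - {k}"
      have T: "K - ?T = {k}" "h \<in> ?T" "k \<notin> ?T"
        using h k by auto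
      have "f i ?T + f e ?T = - \<delta>"
        using pair[of i I\<^sub>1 e ?T] i e disj blocks(1) T
        by (auto simp: tuple_val_row1[OF h] tuple_val_row2)
      moreover have "f e ?T = - \<delta>"
        using val2[OF e(2), of ?T] T by simp
      ultimately have "f i ?T = 0"
        by simp
      then show ?thesis
        using coord[of k ?T i] val1(2)[OF i(2)] k by (simp add: insert_absorb)
    qed
    have ej: "snd (coeff_tuple d i) $ j = 0" if "j \<notin> insert h K" for j
      using coord[of j K i] val1[OF i(2)] that by simp
    \<comment> \<open>The node alone is not tight at the empty set, where its value is
      \<open>card K > 0\<close>; the node coefficient is therefore solved from the tight choice
      \<open>T = K\<close>.\<close>
    have "f i K = fst (coeff_tuple d i) + (\<Sum>j\<in>K. snd (coeff_tuple d i) $ j)"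
      by (simp add: f_def tuple_val_def)
    then have "fst (coeff_tuple d i) = \<delta> * card K"
      using val1(1)[OF i(2)] ek by simp
    then show ?thesis
      using eh ek ej by (auto simp: row1_def prod_eq_iff vec_eq_iff)
  qed
  have "coeff_tuple d i = \<delta> *\<^sub>R coeff_tuple c i" for i
  proof -
    consider "coeff_tuple c i = 0" | "i \<in> I\<^sub>1" "coeff_tuple c i = row1 h K"
      | k where "i \<in> I\<^sub>2" "k \<in> K" "coeff_tuple c i = row2 h k"
      using I1[of i] I2[of i] other[of i] by blast
    then show ?thesis
      by cases (simp_all add: zero_row row1_case row2_case)
  qed
  moreover have "y_coeff d j = \<delta> * y_coeff c j" for j
    using y0 by (simp add: y \<delta>_def)
  ultimately have "fst d = \<delta> *\<^sub>R fst c"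
    by (intro inequality_eq_scaleR)
  then show ?thesis
    by (auto simp: d_def)
qed

lemma facet: "defines_facet (bqp \<I>) c"
proof -
  have "vertex {} {} = (0 :: ('x, 'y) xyz)"
    by (simp add: vertex_def vec_eq_iff zero_prod_def)
  then have zero: "(0 :: ('x, 'y) xyz) \<in> bqp \<I>"
    using vertex_in_bqp[OF one_per_block_empty, of "{} :: 'y set"] by simp
  have "{v \<in> bqp \<I>. fst c \<bullet> v = 0} facet_of bqp \<I>"
  proof (rule facet_of_if_unique_equation)
    show "convex (bqp \<I>)"
      by (simp add: bqp_def)
    \<comment> \<open>At this vertex the left-hand side is 1, so the face is proper.\<close>
    show "vertex {} {h} \<in> bqp \<I>"
      by (rule vertex_in_bqp[OF one_per_block_empty])
    show "fst c \<bullet> vertex {} {h} \<noteq> 0"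
      by (simp add: inner_eq)
  qed (use zero valid rhs unique_equation in \<open>auto simp: valid_ineq_def\<close>)
  then show ?thesis
    using valid by (simp add: defines_facet_def rhs)
qed

end

section \<open>Coefficients of the given inequality and the conclusion\<close>

lemma axis_axis_nth: "axis a (axis b 1) $ k $ l = (of_bool (k = a \<and> l = b) :: real)"
  by (simp add: axis_def)

lemma coeffs_the_inequality:
  "x_coeff (the_inequality m i j) k = (real m - 1) * of_bool (k = i 1)"
  "y_coeff (the_inequality m i j) l = of_bool (l = j 1)"
  "z_coeff (the_inequality m i j) k l =
     - (\<Sum>p=1..m. of_bool (k = i 1 \<and> l = j p))
       + (\<Sum>p=2..m. of_bool (k = i p \<and> l = j p) - of_bool (k = i p \<and> l = j 1))"
  by (simp_all add: the_inequality_def x_coeff_def y_coeff_def z_coeff_def x_unit_def y_unit_def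
      z_unit_def fst_sum snd_sum axis_axis_nth del: sum_of_bool_eq) (simp_all add: axis_def)

lemma sum_of_bool_eq_inj:
  assumes "inj_on g A" "finite A"
  shows "(\<Sum>p\<in>A. of_bool (l = g p)) = (of_bool (l \<in> g ` A) :: real)"
proof -
  have "(\<Sum>p\<in>A. of_bool (l = g p)) = (\<Sum>q\<in>g ` A. of_bool (l = q) :: real)"
    using assms(1) by (simp add: sum.reindex)
  then show ?thesis
    using assms(2) by (simp add: of_bool_def)
qed

theorem theorem3p10:
  fixes \<I> :: "'x::finite set set"
    and I\<^sub>1 I\<^sub>2 :: "'x set"
    and m :: nat
    and i :: "nat \<Rightarrow> 'x"
    and j :: "nat \<Rightarrow> 'y::finite"
  assumes "partition_on (UNIV :: 'x set) \<I>"
    and "m \<ge> 3"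
    and "I\<^sub>1 \<in> \<I>" and "I\<^sub>2 \<in> \<I>" and "I\<^sub>1 \<noteq> I\<^sub>2"
    and "i 1 \<in> I\<^sub>1"
    and "\<forall>p\<in>{2..m}. i p \<in> I\<^sub>2" and "inj_on i {2..m}"
    and "inj_on j {1..m}"
  shows "defines_facet (bqp \<I>) (the_inequality m i j) \<and>
    (\<forall>c. structure_preserving_copying \<I> (the_inequality m i j) c \<longrightarrow>
         defines_facet (bqp \<I>) c)"
proof -
  let ?c = "the_inequality m i j" and ?h = "j 1" and ?K = "j ` {2..m}"
  have disj: "I = J" if "k \<in> I" "k \<in> J" "I \<in> \<I>" "J \<in> \<I>" for k I J
    using assms(1) that by (meson disjnt_iff disjointD disjoint_iff partition_onD2)
  have ne: "i p \<noteq> i 1" if "p \<in> {2..m}" for p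
    using disj assms(3-7) that by metis
  have m: "{1..m} = insert 1 {2..m}"
    using assms(2) by auto
  have jK: "inj_on j {2..m}" and h: "?h \<notin> ?K"
    using assms(9) unfolding m by auto
  have cardK: "real (card ?K) = real m - 1"
    using card_image[OF jK] assms(2) by simp
  have row1: "coeff_tuple ?c (i 1) = row1 ?h ?K"
  proof -
    have "(\<Sum>p=2..m. of_bool (i 1 = i p \<and> l = j p) - of_bool (i 1 = i p \<and> l = j 1)) = (0::real)" for l
      using ne by (intro sum.neutral) (metis diff_0_right of_bool_eq(1))
    then have "z_coeff ?c (i 1) l = - of_bool (l \<in> insert ?h ?K)" for l
      using sum_of_bool_eq_inj[OF assms(9), of l] unfolding coeffs_the_inequality m by simp
    then show ?thesis
      by (simp add: coeff_tuple_def row1_def coeffs_the_inequality(1) cardK)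
  qed
  have row2: "coeff_tuple ?c (i p) = row2 ?h (j p)" if p: "p \<in> {2..m}" for p
  proof -
    \<comment> \<open>Injectivity of \<open>i\<close> leaves only the summand
      \<open>q = p\<close>.\<close>
    have "(\<Sum>q=2..m. of_bool (i p = i q \<and> l = j q) - of_bool (i p = i q \<and> l = j 1))
        = (\<Sum>q=2..m. if q = p then of_bool (l = j p) - of_bool (l = j 1) else 0 :: real)" for l
      using assms(8) p by (intro sum.cong) (auto simp: inj_on_def)
    then have "z_coeff ?c (i p) l = of_bool (l = j p) - of_bool (l = ?h)" for l
      using ne[OF p] p by (simp add: coeffs_the_inequality)
    then show ?thesis
      using ne[OF p] by (simp add: coeff_tuple_def row2_def coeffs_the_inequality(1))
  qed
  have row0: "coeff_tuple ?c k = 0" if "k \<noteq> i 1" "k \<notin> i ` {2..m}" for k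
  proof -
    have "(\<Sum>p=2..m. of_bool (k = i p \<and> l = j p) - of_bool (k = i p \<and> l = j 1)) = (0::real)" for l
      using that by (intro sum.neutral) auto
    then show ?thesis
      using that by (simp add: coeff_tuple_def coeffs_the_inequality zero_prod_def vec_eq_iff)
  qed
  \<comment> \<open>Structure preservation guarantees the occurrence of nonzero tuples only; here
    the coefficient at \<open>?h\<close> is -1 in both cases.\<close>
  have row_ne: "row1 ?h ?K \<noteq> 0" "row2 ?h k \<noteq> 0" if "k \<in> ?K" for k
    using that h by (auto simp: row1_def row2_def zero_prod_def vec_eq_iff)
  have key: "defines_facet (bqp \<I>) c" if "structure_preserving_copying \<I> ?c c" for c
  proof -
    have copy: "\<And>I k. I \<in> \<I> \<Longrightarrow> k \<in> I \<Longrightarrow> coeff_tuple c k \<in> coeff_tuple ?c ` I"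
      and yc: "\<And>l. y_coeff c l = y_coeff ?c l" and rhs: "snd c = snd ?c"
      and pres: "\<And>I r. I \<in> \<I> \<Longrightarrow> r \<in> coeff_tuple ?c ` I \<Longrightarrow> r \<noteq> 0 \<Longrightarrow> \<exists>k\<in>I. coeff_tuple c k = r"
      using that by (auto simp: structure_preserving_copying_def copying_def coeff_tuples_def)
    have block1: "coeff_tuple ?c k \<in> {0, row1 ?h ?K}" if "k \<in> I\<^sub>1" for k
      using row0[of k] row1 disj[of k I\<^sub>1 I\<^sub>2] assms(3-7) that by auto
    have block2: "coeff_tuple ?c k \<in> insert 0 (row2 ?h ` ?K)" if "k \<in> I\<^sub>2" for k
    proof -
      have "k \<noteq> i 1"
        using disj assms(3-6) that by metis
      then show ?thesis
        using row0[of k] row2 by (cases "k \<in> i ` {2..m}") auto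
    qed
    have block0: "coeff_tuple ?c k = 0" if "k \<notin> I\<^sub>1" "k \<notin> I\<^sub>2" for k
      using row0[of k] assms(6,7) that by auto
    interpret copied_inequality \<I> I\<^sub>1 I\<^sub>2 ?h ?K c
    proof
      show "?K \<noteq> {}"
        using assms(2) by auto
      show "snd c = 0"
        by (simp add: rhs the_inequality_def)
      show "y_coeff c l = of_bool (l = ?h)" for l
        by (simp add: yc coeffs_the_inequality)
      show "coeff_tuple c k \<in> {0, row1 ?h ?K}" if "k \<in> I\<^sub>1" for k
        using copy[OF assms(3) that] block1 by (metis imageE)
      show "coeff_tuple c k \<in> insert 0 (row2 ?h ` ?K)" if "k \<in> I\<^sub>2" for k
        using copy[OF assms(4) that] block2 by (metis imageE)
      \<comment> \<open>Tuples are copied only within a block, and any third block has only zero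
        tuples to offer.\<close>
      show "coeff_tuple c k = 0" if k: "k \<notin> I\<^sub>1" "k \<notin> I\<^sub>2" for k
      proof -
        obtain I where I: "I \<in> \<I>" "k \<in> I"
          using assms(1) by (metis UNIV_I UnionE partition_onD1)
        then have "I \<noteq> I\<^sub>1" "I \<noteq> I\<^sub>2"
          using k by auto
        then have "l \<notin> I\<^sub>1 \<and> l \<notin> I\<^sub>2" if "l \<in> I" for l
          using disj[OF that _ I(1)] assms(3,4) by blast
        then show ?thesis
          using copy[OF I] block0 by auto
      qed
      show "\<exists>k\<in>I\<^sub>1. coeff_tuple c k = row1 ?h ?K"
      proof (rule pres[OF assms(3)])
        show "row1 ?h ?K \<in> coeff_tuple ?c ` I\<^sub>1"
          using row1 assms(6) by (metis imageI)
        show "row1 ?h ?K \<noteq> 0"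
          using row_ne(1)[of "j 2"] assms(2) by simp
      qed
      show "\<exists>k\<in>I\<^sub>2. coeff_tuple c k = row2 ?h l" if "l \<in> ?K" for l
      proof (rule pres[OF assms(4)])
        obtain p where "p \<in> {2..m}" "l = j p"
          using \<open>l \<in> ?K\<close> by blast
        then show "row2 ?h l \<in> coeff_tuple ?c ` I\<^sub>2"
          using row2 assms(7) by (metis imageI)
        show "row2 ?h l \<noteq> 0"
          using row_ne(2)[OF \<open>l \<in> ?K\<close>] .
      qed
    qed (use assms h in auto)
    show ?thesis
      by (rule facet)
  qed
  \<comment> \<open>Keeping every tuple in place is itself such a copying, so \<open>key\<close>
    also covers the original inequality.\<close>
  have "structure_preserving_copying \<I> ?c ?c"
    by (auto simp: structure_preserving_copying_def copying_def coeff_tuples_def)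
  then show ?thesis
    using key by blast
qed

end
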